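(* Let $n\geq 3$ and let $D_n=\langle a,b\mid a^n=b^2=1,\ ab=ba^{-1}\rangle$. For a positive divisor $r$ of $n$ and $1\le i\le n/r$ let $H_i^r=\langle a^{n/r}, ba^{i-1}\rangle$, and let $x_i^r$ be the number of pairs $(s,j)$ with $s$ a positive divisor of $n$, $1\le j\le n/s$, such that $\frac{n}{\mathrm{lcm}(r,s)}$ divides $2(i-j)$. (i) If $n$ is odd, then $\deg_{\Gamma_N(D_n)}(H_i^r)=x_i^r-2$ for every divisor $r$ of $n$ with $r\neq n$ and every $i=1,\dots,n/r$. (ii) If $n$ is even, then $\deg_{\Gamma_N(D_n)}(H_i^r)=x_i^r-4$ for every divisor $r$ of $n$ with $r\neq n, \frac n2$ and every $i=1,\dots,n/r$.
   Context: $\Gamma_N(G)$ denotes the simple graph whose vertices are the proper non-normal subgroups of $G$, two distinct vertices $H,K$ being adjacent iff $HK=KH$. The subgroups $H_i^r$ ($r\mid n$, $1\le i\le n/r$) are exactly the subgroups of $D_n$ not contained in $\langle a\rangle$ (note $H_1^n=D_n$); two of them, $H_i^r$ and $H_j^s$, permute iff $\frac{n}{\mathrm{lcm}(r,s)}\mid 2(i-j)$. *)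

theory Defs
  imports "HOL-Algebra.Coset" "HOL-Algebra.Generated_Groups"
begin

text \<open>
  Groups given by generators and relations. A word is a list of letters \<open>(x, True)\<close>, standing for
  the generator \<open>x\<close>, and \<open>(x, False)\<close>, standing for its formal inverse. A relation \<open>l = r\<close> is the
  pair \<open>(l, r)\<close>. All elements of the type \<open>'x\<close> are generators.
\<close>

type_synonym 'x gword = "('x \<times> bool) list"

inductive word_eq :: "('x gword \<times> 'x gword) set \<Rightarrow> 'x gword \<Rightarrow> 'x gword \<Rightarrow> bool"
  for R :: "('x gword \<times> 'x gword) set" where
  refl: "word_eq R u u"
| sym: "word_eq R u v \<Longrightarrow> word_eq R v u"
| trans: "word_eq R u v \<Longrightarrow> word_eq R v w \<Longrightarrow> word_eq R u w"
| cancel: "word_eq R (u @ [(x, e), (x, \<not> e)] @ v) (u @ v)"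
| relation: "(l, r) \<in> R \<Longrightarrow> word_eq R (u @ l @ v) (u @ r @ v)"

definition word_rel :: "('x gword \<times> 'x gword) set \<Rightarrow> ('x gword \<times> 'x gword) set" where
  "word_rel R = {(u, v). word_eq R u v}"

definition word_class :: "('x gword \<times> 'x gword) set \<Rightarrow> 'x gword \<Rightarrow> 'x gword set" where
  "word_class R u = word_rel R `` {u}"

definition presented_group :: "('x gword \<times> 'x gword) set \<Rightarrow> 'x gword set monoid" where
  "presented_group R =
     \<lparr>carrier = UNIV // word_rel R,
      monoid.mult = (\<lambda>S T. \<Union>u\<in>S. \<Union>v\<in>T. word_class R (u @ v)),
      monoid.one = word_class R []\<rparr>"

lemma equiv_word_rel: "equiv UNIV (word_rel R)"
proof (rule equivI)
  show "refl (word_rel R)"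
    by (simp add: word_rel_def refl_on_def word_eq.refl)
  show "sym (word_rel R)"
    by (simp add: word_rel_def sym_def word_eq.sym)
  show "trans (word_rel R)"
    unfolding word_rel_def trans_def by (blast intro: word_eq.trans)
qed simp

lemma word_class_eq_iff: "word_class R u = word_class R v \<longleftrightarrow> word_eq R u v"
  using equiv_word_rel[of R] by (simp add: word_class_def eq_equiv_class_iff) (simp add: word_rel_def)

lemma carrier_presented_group: "carrier (presented_group R) = range (word_class R)"
  by (auto simp: presented_group_def quotient_def word_class_def)

lemma word_eq_append:
  assumes "word_eq R u u'" and "word_eq R v v'"
  shows "word_eq R (u @ v) (u' @ v')"
proof -
  have l: "word_eq R (p @ w) (p' @ w)" if "word_eq R p p'" for p p' w
    using that
  proof induction
    case (cancel p x e q)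
    then show ?case using word_eq.cancel[of R p x e "q @ w"] by simp
  next
    case (relation l r p q)
    then show ?case using word_eq.relation[of l r R p "q @ w"] by simp
  next
    case (trans p q s)
    then show ?case by (blast intro: word_eq.trans)
  next
    case (sym p q)
    then show ?case by (blast intro: word_eq.sym)
  qed (rule word_eq.refl)
  have r: "word_eq R (w @ p) (w @ p')" if "word_eq R p p'" for p p' w
    using that
  proof induction
    case (cancel p x e q)
    then show ?case using word_eq.cancel[of R "w @ p" x e q] by simp
  next
    case (relation l r p q)
    then show ?case using word_eq.relation[of l r R "w @ p" q] by simp
  next
    case (trans p q s)
    then show ?case by (blast intro: word_eq.trans)
  next
    case (sym p q)
    then show ?case by (blast intro: word_eq.sym)
  qed (rule word_eq.refl)
  show ?thesis using l[OF assms(1)] r[OF assms(2)] by (rule word_eq.trans)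
qed

lemma mult_presented_group:
  "word_class R u \<otimes>\<^bsub>presented_group R\<^esub> word_class R v = word_class R (u @ v)"
proof -
  have mem: "w \<in> word_class R w' \<longleftrightarrow> word_eq R w' w" for w w'
    by (simp add: word_class_def word_rel_def)
  have "word_class R (u' @ v') = word_class R (u @ v)"
    if "u' \<in> word_class R u" "v' \<in> word_class R v" for u' v'
    using word_eq.sym[OF word_eq_append[of R u u' v v']] that
    by (simp add: word_class_eq_iff mem)
  moreover have "u \<in> word_class R u" "v \<in> word_class R v"
    by (simp_all add: mem word_eq.refl)
  ultimately have "(\<Union>u'\<in>word_class R u. \<Union>v'\<in>word_class R v. word_class R (u' @ v')) = word_class R (u @ v)"
    by blast
  then show ?thesis
    by (simp add: presented_group_def)
qed

lemma one_presented_group: "\<one>\<^bsub>presented_group R\<^esub> = word_class R []"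
  by (simp add: presented_group_def)

lemma group_presented_group: "group (presented_group R)"
proof (rule groupI)
  fix S assume "S \<in> carrier (presented_group R)"
  then obtain u where S: "S = word_class R u" by (auto simp: carrier_presented_group)
  define u' where "u' = rev (map (\<lambda>(x, e). (x, \<not> e)) u)"
  have "word_eq R (rev (map (\<lambda>(x, e). (x, \<not> e)) w) @ w) []" for w
  proof (induction w)
    case (Cons p w)
    obtain x e where p: "p = (x, e)" by force
    show ?case
      using word_eq.trans[OF word_eq.cancel[of R "rev (map (\<lambda>(x, e). (x, \<not> e)) w)" x "\<not> e" w] Cons]
      by (simp add: p)
  qed (simp add: word_eq.refl)
  then have "word_class R u' \<otimes>\<^bsub>presented_group R\<^esub> S = \<one>\<^bsub>presented_group R\<^esub>"
    by (simp add: S u'_def mult_presented_group one_presented_group word_class_eq_iff)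
  then show "\<exists>T\<in>carrier (presented_group R). T \<otimes>\<^bsub>presented_group R\<^esub> S = \<one>\<^bsub>presented_group R\<^esub>"
    by (auto simp: carrier_presented_group)
qed (auto simp: carrier_presented_group mult_presented_group one_presented_group)

datatype dihedral_gen = A | B

definition dihedral_relations :: "nat \<Rightarrow> (dihedral_gen gword \<times> dihedral_gen gword) set" where
  "dihedral_relations n =
     {(replicate n (A, True), []),
      ([(B, True), (B, True)], []),
      ([(A, True), (B, True)], [(B, True), (A, False)])}"

definition dihedral_group :: "nat \<Rightarrow> dihedral_gen gword set monoid" where
  "dihedral_group n = presented_group (dihedral_relations n)"

definition gen_a :: "nat \<Rightarrow> dihedral_gen gword set" where
  "gen_a n = word_class (dihedral_relations n) [(A, True)]"

definition gen_b :: "nat \<Rightarrow> dihedral_gen gword set" where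
  "gen_b n = word_class (dihedral_relations n) [(B, True)]"

text \<open>\<open>H_sub n r i\<close> is $H_i^r$; it is meant for $r$ dividing $n$ and $i \ge 1$, so that neither the
  division nor the subtraction truncates.\<close>

definition H_sub :: "nat \<Rightarrow> nat \<Rightarrow> nat \<Rightarrow> dihedral_gen gword set set" where
  "H_sub n r i =
     generate (dihedral_group n)
       {gen_a n [^]\<^bsub>dihedral_group n\<^esub> (n div r),
        gen_b n \<otimes>\<^bsub>dihedral_group n\<^esub> gen_a n [^]\<^bsub>dihedral_group n\<^esub> (i - 1)}"

definition x_count :: "nat \<Rightarrow> nat \<Rightarrow> nat \<Rightarrow> nat" where
  "x_count n r i =
     card {(s, j). 0 < s \<and> s dvd n \<and> 1 \<le> j \<and> j \<le> n div s \<and>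
                   int (n div lcm r s) dvd 2 * (int i - int j)}"

text \<open>The permutability graph of non-normal subgroups $\Gamma_N(G)$.\<close>

definition GammaN_verts :: "('a, 'b) monoid_scheme \<Rightarrow> 'a set set" where
  "GammaN_verts G = {H. subgroup H G \<and> H \<noteq> carrier G \<and> \<not> H \<lhd> G}"

definition GammaN_adj :: "('a, 'b) monoid_scheme \<Rightarrow> 'a set \<Rightarrow> 'a set \<Rightarrow> bool" where
  "GammaN_adj G H K \<longleftrightarrow>
     H \<in> GammaN_verts G \<and> K \<in> GammaN_verts G \<and> H \<noteq> K \<and> H <#>\<^bsub>G\<^esub> K = K <#>\<^bsub>G\<^esub> H"

definition GammaN_degree :: "('a, 'b) monoid_scheme \<Rightarrow> 'a set \<Rightarrow> nat" where
  "GammaN_degree G H = card {K. GammaN_adj G H K}"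

end

theory Submission
  imports Defs
begin

text \<open>
  Every element of $D_n$ is uniquely $b^e a^x$ with $e \in \{0,1\}$ and $x$ modulo $n$; uniqueness
  comes from letting words act on pairs $(e, x)$. In these coordinates $H_i^r$ consists of the
  $a^x$ with $m \mid x$ and the $b a^x$ with $m \mid x - (i - 1)$, where $m = n/r$, and it is normal
  iff $m \mid 2$. A subgroup inside $\langle a\rangle$ is normal, so the vertices of the graph are
  the $H_j^s$ with $n/s \nmid 2$. The degree is therefore the number of pairs counted by $x_i^r$
  minus $(r,i)$ itself and the pairs with $n/s \mid 2$, all of which satisfy the divisibility
  condition: one pair for odd $n$, three for even $n$.
\<close>

section \<open>Arithmetic\<close>

lemma dvd_two_iff_nat: "k dvd 2 \<longleftrightarrow> k = 1 \<or> k = 2" for k :: nat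
proof
  assume "k dvd 2"
  then have "k \<le> 2" by (rule dvd_imp_le) simp
  moreover have "k \<noteq> 0" using \<open>k dvd 2\<close> by (intro notI) simp
  ultimately show "k = 1 \<or> k = 2" by auto
qed auto

text \<open>Passing to complementary divisors of \<open>n\<close> reverses divisibility, so it turns
  lcm into gcd. This translates the modulus of \<open>x_count\<close> into the gcd that governs
  products of subgroups.\<close>

lemma gcd_div_div_eq_div_lcm:
  fixes n r s :: nat
  assumes "0 < n" "r dvd n" "s dvd n"
  shows "gcd (n div r) (n div s) = n div lcm r s"
proof -
  obtain k l where k: "n = r * k" and l: "n = s * l" using assms(2,3) by (blast elim: dvdE)
  have pos: "r > 0" "s > 0" "k > 0" "l > 0" using k l \<open>0 < n\<close> by (auto intro!: Nat.gr0I)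
  define g where "g = gcd k l"
  have "g > 0" using pos by (simp add: g_def)
  have dvd: "lcm r s dvd n" using assms by simp
  then obtain t where t: "n = lcm r s * t" by blast
  have "t dvd k"
  proof -
    have "r * k = r * ((lcm r s div r) * t)" using k t by (simp add: mult.assoc[symmetric])
    then show ?thesis using pos by simp
  qed
  moreover have "t dvd l"
  proof -
    have "s * l = s * ((lcm r s div s) * t)" using l t by (simp add: mult.assoc[symmetric])
    then show ?thesis using pos by simp
  qed
  ultimately have tg: "t dvd g" by (simp add: g_def)
  have "g dvd n" using k by (simp add: g_def)
  \<comment> \<open>Conversely, \<open>n div g\<close> is a common multiple of \<open>r\<close> and
    \<open>s\<close>, hence a multiple of their lcm; cancelling the lcm gives
    \<open>g dvd t\<close>.\<close>
  have "r dvd n div g"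
  proof -
    have "n div g = r * (k div g)" using k by (simp add: g_def div_mult_swap)
    then show ?thesis by simp
  qed
  moreover have "s dvd n div g"
  proof -
    have "n div g = s * (l div g)" using l by (simp add: g_def div_mult_swap)
    then show ?thesis by simp
  qed
  ultimately have "lcm r s dvd n div g" by simp
  then have "lcm r s * g dvd n div g * g" by (rule mult_dvd_mono) simp
  then have "lcm r s * g dvd lcm r s * t" by (simp only: dvd_div_mult_self[OF \<open>g dvd n\<close>] t[symmetric])
  then have "g dvd t" using pos by (simp add: lcm_eq_0_iff)
  with tg have "g = t" by (rule dvd_antisym[rotated])
  moreover have "n div lcm r s = t" using t pos by (simp add: lcm_eq_0_iff)
  moreover have "n div r = k" using k pos by simp
  moreover have "n div s = l" using l pos by simp
  ultimately show ?thesis by (simp add: g_def)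
qed

text \<open>Chinese remainder theorem for moduli that need not be coprime. It eliminates the unknown
  exponent of a factor in a product of two subgroups.\<close>

lemma ex_cong_both_iff_gcd_dvd:
  fixes k l p q :: int
  shows "(\<exists>y. k dvd y - p \<and> l dvd y - q) \<longleftrightarrow> gcd k l dvd p - q"
proof
  assume "\<exists>y. k dvd y - p \<and> l dvd y - q"
  then obtain y where "gcd k l dvd y - p" "gcd k l dvd y - q"
    by (meson dvd_trans gcd_dvd1 gcd_dvd2)
  then have "gcd k l dvd (y - q) - (y - p)" by (rule dvd_diff[rotated])
  then show "gcd k l dvd p - q" by simp
next
  assume "gcd k l dvd p - q"
  then obtain t where t: "p - q = gcd k l * t" by blast
  obtain u v where uv: "u * k + v * l = gcd k l" using bezout_int by blast
  have "p - q = k * (u * t) + l * (v * t)"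
    unfolding t uv[symmetric] by (simp add: algebra_simps)
  \<comment> \<open>Bezout splits \<open>p - q\<close> into a multiple of \<open>k\<close> and a
    multiple of \<open>l\<close>; removing the former from \<open>p\<close> gives the
    witness.\<close>
  then have "(p - k * (u * t)) - p = k * (- (u * t))" "(p - k * (u * t)) - q = l * (v * t)"
    by (simp_all add: algebra_simps)
  then show "\<exists>y. k dvd y - p \<and> l dvd y - q" by (metis dvd_triv_left)
qed

text \<open>Subgroups of the integers are cyclic; the positive member \<open>N\<close> excludes the
  zero subgroup and forces \<open>d dvd N\<close>. It is applied to the exponents of the rotations
  in a subgroup.\<close>

lemma int_subgroup_eq_multiples:
  fixes T :: "int set" and N :: int
  assumes diff: "\<And>x y. x \<in> T \<Longrightarrow> y \<in> T \<Longrightarrow> x - y \<in> T" and "N \<in> T" "0 < N"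
  obtains d where "0 < d" "d dvd N" "\<And>x. x \<in> T \<longleftrightarrow> d dvd x"
proof -
  have zero: "0 \<in> T" using diff[OF \<open>N \<in> T\<close> \<open>N \<in> T\<close>] by simp
  have neg: "- x \<in> T" if "x \<in> T" for x using diff[OF zero that] by simp
  have add: "x + y \<in> T" if "x \<in> T" "y \<in> T" for x y using diff[OF that(1) neg[OF that(2)]] by simp
  have natmult: "int k * x \<in> T" if "x \<in> T" for k x
    by (induction k) (simp_all add: zero add that distrib_right)
  have mult: "k * x \<in> T" if "x \<in> T" for k x
    by (cases k) (use natmult[OF that] neg in \<open>auto simp del: of_nat_Suc\<close>)
  \<comment> \<open>The least positive member generates: a nonzero remainder modulo \<open>d\<close>
    would be a smaller one.\<close>
  define d where "d = (LEAST k. 0 < k \<and> int k \<in> T)"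
  have ex: "0 < nat N \<and> int (nat N) \<in> T" using assms by simp
  have d: "0 < d" "int d \<in> T" using LeastI[of "\<lambda>k. 0 < k \<and> int k \<in> T", OF ex] by (auto simp: d_def)
  have *: "x \<in> T \<longleftrightarrow> int d dvd x" for x
  proof
    assume "x \<in> T"
    then have "x mod int d \<in> T"
      using diff[OF \<open>x \<in> T\<close> mult[OF d(2), of "x div int d"]] by (simp add: minus_div_mult_eq_mod)
    moreover have "d \<le> k" if "0 < k" "int k \<in> T" for k
      using that unfolding d_def by (intro Least_le conjI)
    ultimately have "0 < nat (x mod int d) \<Longrightarrow> d \<le> nat (x mod int d)" by simp
    then have "x mod int d = 0"
      using pos_mod_bound[of "int d" x] pos_mod_sign[of "int d" x] d(1) by linarith
    then show "int d dvd x" by (simp add: dvd_eq_mod_eq_0)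
  next
    assume "int d dvd x"
    then show "x \<in> T" using mult[OF d(2)] by (metis dvd_def mult.commute)
  qed
  show ?thesis using that[of "int d"] d(1) * \<open>N \<in> T\<close> by simp
qed

section \<open>Dihedral groups in coordinates\<close>

text \<open>\<open>el e x\<close> stands for $b^e a^x$.\<close>

locale dihedral_coords = group G for G (structure) +
  fixes el :: "bool \<Rightarrow> int \<Rightarrow> 'a" and N :: int
  assumes N_pos: "0 < N"
    and carrier_eq: "carrier G = {el e x | e x. True}"
    and el_eq_iff: "el e x = el f y \<longleftrightarrow> e = f \<and> N dvd x - y"
    and el_mult: "el e x \<otimes> el f y = el (e \<noteq> f) (y + (if f then - x else x))"
begin

lemma el_closed [simp]: "el e x \<in> carrier G"
  by (auto simp: carrier_eq)

lemma one_eq_el: "\<one> = el False 0"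
  by (rule one_unique[symmetric]) (auto simp: carrier_eq el_mult)

lemma inv_el: "inv (el e x) = el e (if e then x else - x)"
  by (rule inv_equality) (simp_all add: el_mult one_eq_el)

section \<open>Subgroups that contain a reflection, and normality\<close>

definition dih_sub :: "int \<Rightarrow> int \<Rightarrow> 'a set" where
  "dih_sub m c = {el e x | e x. m dvd x - (if e then c else 0)}"

text \<open>An exponent is determined only modulo \<open>N\<close>; \<open>m dvd N\<close> makes the
  congruence modulo \<open>m\<close> independent of the representative.\<close>

lemma el_in_dih_sub_iff:
  assumes "m dvd N"
  shows "el e x \<in> dih_sub m c \<longleftrightarrow> m dvd x - (if e then c else 0)"
proof
  assume "el e x \<in> dih_sub m c"
  then obtain y where "N dvd x - y" and y: "m dvd y - (if e then c else 0)"
    by (auto simp: dih_sub_def el_eq_iff)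
  then have "m dvd x - y" using assms dvd_trans by blast
  from dvd_add[OF this y] show "m dvd x - (if e then c else 0)" by simp
next
  assume "m dvd x - (if e then c else 0)"
  then show "el e x \<in> dih_sub m c"
    unfolding dih_sub_def by (intro CollectI exI[of _ e] exI[of _ x] conjI) simp_all
qed

lemma set_eq_iff_el:
  assumes "H \<subseteq> carrier G" "K \<subseteq> carrier G"
  shows "H = K \<longleftrightarrow> (\<forall>e x. el e x \<in> H \<longleftrightarrow> el e x \<in> K)"
proof
  assume *: "\<forall>e x. el e x \<in> H \<longleftrightarrow> el e x \<in> K"
  have "h \<in> H \<longleftrightarrow> h \<in> K" if "h \<in> carrier G" for h
    using that * unfolding carrier_eq by blast
  then show "H = K" using assms by blast
qed simp

lemma dih_sub_subset: "dih_sub m c \<subseteq> carrier G"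
  by (auto simp: dih_sub_def)

text \<open>The rotations in the subgroup determine \<open>m\<close>, the reflections determine
  \<open>c\<close> modulo \<open>m\<close>.\<close>

lemma dih_sub_eq_iff:
  assumes "m dvd N" "0 < m" "k dvd N" "0 < k"
  shows "dih_sub m c = dih_sub k d \<longleftrightarrow> m = k \<and> m dvd c - d"
proof
  assume eq: "dih_sub m c = dih_sub k d"
  have *: "m dvd x \<longleftrightarrow> k dvd x" for x
    using el_in_dih_sub_iff[OF assms(1), of False x c] el_in_dih_sub_iff[OF assms(3), of False x d]
    by (simp add: eq)
  have "m = k"
    using *[of m] *[of k] assms(2,4) zdvd_antisym_nonneg[of m k] by force
  moreover have "m dvd c - d"
    using el_in_dih_sub_iff[OF assms(1), of True c c] el_in_dih_sub_iff[OF assms(3), of True c d]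
    by (simp add: \<open>m = k\<close> flip: eq)
  ultimately show "m = k \<and> m dvd c - d" ..
next
  assume "m = k \<and> m dvd c - d"
  then have mk: "m = k" and d: "m dvd c - d" by auto
  have *: "m dvd x - c \<longleftrightarrow> m dvd x - d" for x
    using dvd_add_left_iff[OF d, of "x - c"] by simp
  then show "dih_sub m c = dih_sub k d"
    unfolding mk[symmetric] set_eq_iff_el[OF dih_sub_subset dih_sub_subset]
    by (simp add: el_in_dih_sub_iff[OF assms(1)] *)
qed

lemma subgroup_dih_sub:
  assumes "m dvd N"
  shows "subgroup (dih_sub m c) G"
proof (rule subgroupI)
  fix h k assume "h \<in> dih_sub m c" "k \<in> dih_sub m c"
  then obtain e x f y where h: "h = el e x" "m dvd x - (if e then c else 0)"
    and k: "k = el f y" "m dvd y - (if f then c else 0)" by (auto simp: dih_sub_def)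
  \<comment> \<open>The offsets \<open>x - (if e then c else 0)\<close> combine by the same rule as
    the exponents in \<open>el_mult\<close>.\<close>
  have "m dvd (y - (if f then c else 0)) +
      (if f then - (x - (if e then c else 0)) else x - (if e then c else 0))"
    using h(2) k(2) by (intro dvd_add) (cases f; simp only: if_True if_False dvd_minus_iff)+
  also have "\<dots> = y + (if f then - x else x) - (if e \<noteq> f then c else 0)" by auto
  finally show "h \<otimes> k \<in> dih_sub m c"
    by (simp only: h(1) k(1) el_mult el_in_dih_sub_iff[OF assms])
next
  fix h assume "h \<in> dih_sub m c"
  then obtain e x where h: "h = el e x" "m dvd x - (if e then c else 0)" by (auto simp: dih_sub_def)
  then show "inv h \<in> dih_sub m c"
    by (cases e) (simp_all add: inv_el el_in_dih_sub_iff[OF assms])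
next
  show "dih_sub m c \<noteq> {}" using el_in_dih_sub_iff[OF assms, of False 0 c] by auto
qed (rule dih_sub_subset)

lemma el_mult_pow: "el e x \<otimes> el False y [^] (k::nat) = el e (x + int k * y)"
proof (induction k)
  case 0
  then show ?case by simp
next
  case (Suc k)
  have "el e x \<otimes> el False y [^] Suc k = (el e x \<otimes> el False y [^] k) \<otimes> el False y"
    by (simp add: m_assoc)
  then show ?case by (simp add: Suc el_mult algebra_simps)
qed

lemma generate_eq_dih_sub:
  assumes "m dvd N" "0 < m"
  shows "generate G {el False m, el True c} = dih_sub m c" (is "generate G ?S = _")
proof
  show "generate G ?S \<subseteq> dih_sub m c"
    by (rule generate_subgroup_incl) (simp_all add: subgroup_dih_sub assms el_in_dih_sub_iff)
next
  interpret S: subgroup "generate G ?S" G by (rule generate_is_subgroup) simp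
  have gens: "el False m \<in> generate G ?S" "el True c \<in> generate G ?S"
    by (auto intro: generate.incl)
  then have powmem: "el False m [^] (k::nat) \<in> generate G ?S" for k
    by (induction k) simp_all
  show "dih_sub m c \<subseteq> generate G ?S"
  proof
    fix h assume "h \<in> dih_sub m c"
    then obtain e x where h: "h = el e x" "m dvd x - (if e then c else 0)"
      by (auto simp: dih_sub_def)
    define z where "z = (if e then c else 0)"
    \<comment> \<open>Starting from the identity or \<open>el True c\<close>, the quotient says how
      many factors \<open>el False m\<close> are needed. Reducing it modulo \<open>N\<close> makes
      it a natural number and changes the exponent only by a multiple of \<open>N\<close>.\<close>
    define k where "k = nat (((x - z) div m) mod N)"
    have z: "el e z \<in> generate G ?S"
      using gens(2) S.one_closed unfolding one_eq_el by (cases e) (simp_all add: z_def)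
    have "x - (z + int k * m) = ((x - z) div m - ((x - z) div m) mod N) * m"
      using h(2) N_pos by (simp add: z_def k_def algebra_simps)
    also have "N dvd \<dots>" by (simp add: minus_mod_eq_mult_div)
    finally have "h = el e (z + int k * m)" using h(1) by (simp add: el_eq_iff)
    also have "\<dots> = el e z \<otimes> el False m [^] k" by (simp add: el_mult_pow)
    also have "\<dots> \<in> generate G ?S" using z powmem by simp
    finally show "h \<in> generate G ?S" .
  qed
qed

text \<open>The rotation exponents form a subgroup of the integers containing \<open>N\<close>, so
  they are the multiples of some \<open>d\<close>. A single reflection in \<open>H\<close> then
  carries the rotations onto all the reflections, whose exponents form one residue class modulo
  \<open>d\<close>.\<close>

lemma subgroup_cases:
  assumes "subgroup H G"
  obtains (rotations) "\<And>e x. el e x \<in> H \<Longrightarrow> \<not> e"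
    | (dih_sub) m c where "0 < m" "m dvd N" "0 \<le> c" "c < m" "H = dih_sub m c"
proof (cases "\<exists>c. el True c \<in> H")
  case False
  then show ?thesis using rotations by (metis (full_types))
next
  case True
  then obtain c where c: "el True c \<in> H" by blast
  interpret H: subgroup H G by (rule assms)
  have "x - y \<in> {x. el False x \<in> H}"
    if "x \<in> {x. el False x \<in> H}" "y \<in> {x. el False x \<in> H}" for x y
    using H.m_closed[OF _ H.m_inv_closed, of "el False x" "el False y"] that
    by (simp add: inv_el el_mult)
  moreover have "el False N = \<one>" by (simp add: one_eq_el el_eq_iff)
  then have "N \<in> {x. el False x \<in> H}" by simp
  ultimately obtain d where d: "0 < d" "d dvd N" and mem: "\<And>x. el False x \<in> H \<longleftrightarrow> d dvd x"
    using int_subgroup_eq_multiples[of "{x. el False x \<in> H}" N] N_pos by auto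
  have "el True x \<in> H \<longleftrightarrow> d dvd x - c" for x
  proof -
    \<comment> \<open>Multiplication by the involution \<open>el True c\<close> turns
      \<open>el True x\<close> into the rotation with exponent \<open>x - c\<close>.\<close>
    have "el True x \<in> H \<longleftrightarrow> el True c \<otimes> el True x \<in> H"
    proof
      assume "el True c \<otimes> el True x \<in> H"
      then have "el True c \<otimes> (el True c \<otimes> el True x) \<in> H" using c by simp
      then show "el True x \<in> H" by (simp add: el_mult)
    qed (use c in simp)
    then show ?thesis by (simp add: el_mult mem)
  qed
  then have "H = dih_sub d c"
    using mem by (simp add: set_eq_iff_el[OF H.subset dih_sub_subset] el_in_dih_sub_iff d split: if_splits)
  also have "\<dots> = dih_sub d (c mod d)"
    by (simp add: dih_sub_eq_iff d minus_mod_eq_mult_div)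
  finally show ?thesis using d by (intro dih_sub[of d "c mod d"]) simp_all
qed

text \<open>Conjugation fixes a rotation or inverts it, according to whether the conjugating element
  is a rotation or a reflection.\<close>

lemma normal_if_rotations:
  assumes "subgroup H G" "\<And>e x. el e x \<in> H \<Longrightarrow> \<not> e"
  shows "H \<lhd> G"
  unfolding normal_inv_iff
proof (intro conjI ballI assms(1))
  interpret H: subgroup H G by (rule assms)
  fix g h assume "g \<in> carrier G" "h \<in> H"
  then obtain e x f y where g: "g = el e x" and h: "h = el f y"
    using H.subset by (auto simp: carrier_eq)
  have "\<not> f" using assms \<open>h \<in> H\<close> h by blast
  then have "g \<otimes> h \<otimes> inv g = (if e then inv h else h)"
    by (simp add: g h inv_el el_mult)
  then show "g \<otimes> h \<otimes> inv g \<in> H" using \<open>h \<in> H\<close> by simp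
qed

text \<open>Conjugating \<open>el True c\<close> by \<open>el False 1\<close> lowers its exponent by
  2, which forces \<open>m dvd 2\<close>. Conversely, conjugation changes the exponent of a
  reflection by an even number and sends a rotation to itself or its inverse.\<close>

lemma normal_dih_sub_iff:
  assumes "m dvd N"
  shows "dih_sub m c \<lhd> G \<longleftrightarrow> m dvd 2"
proof
  assume "dih_sub m c \<lhd> G"
  then have "el False 1 \<otimes> el True c \<otimes> inv (el False 1) \<in> dih_sub m c"
    by (auto simp: normal_inv_iff el_in_dih_sub_iff assms)
  then have "m dvd -2" by (simp add: el_mult inv_el el_in_dih_sub_iff[OF assms])
  then show "m dvd 2" by simp
next
  assume two: "m dvd 2"
  show "dih_sub m c \<lhd> G"
    unfolding normal_inv_iff
  proof (intro conjI ballI subgroup_dih_sub assms)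
    fix g h assume "g \<in> carrier G" "h \<in> dih_sub m c"
    then obtain e x f y where g: "g = el e x" and h: "h = el f y" "m dvd y - (if f then c else 0)"
      by (auto simp: carrier_eq dih_sub_def)
    have tw: "m dvd 2 * t" for t using two by simp
    consider "\<not> f" | "f" "e" | "f" "\<not> e" by blast
    then show "g \<otimes> h \<otimes> inv g \<in> dih_sub m c"
    proof cases
      case 1
      then show ?thesis using h by (auto simp: g inv_el el_mult el_in_dih_sub_iff[OF assms])
    next
      case 2
      then have "m dvd (y - c) + 2 * (x - y)" using h tw by (intro dvd_add) simp_all
      also have "(y - c) + 2 * (x - y) = 2 * x - y - c" by simp
      finally show ?thesis using 2 by (simp add: g h inv_el el_mult el_in_dih_sub_iff[OF assms])
    next
      case 3
      then have "m dvd (y - c) + 2 * (- x)" using h tw by (intro dvd_add) simp_all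
      also have "(y - c) + 2 * (- x) = y - 2 * x - c" by simp
      finally show ?thesis using 3 by (simp add: g h inv_el el_mult el_in_dih_sub_iff[OF assms])
    qed
  qed
qed

lemma GammaN_verts_eq:
  "GammaN_verts G = {dih_sub m c | m c. 0 < m \<and> m dvd N \<and> 0 \<le> c \<and> c < m \<and> \<not> m dvd 2}"
proof (intro equalityI subsetI)
  fix H assume "H \<in> GammaN_verts G"
  then have sub: "subgroup H G" and nn: "\<not> H \<lhd> G" by (auto simp: GammaN_verts_def)
  from sub show "H \<in> {dih_sub m c | m c. 0 < m \<and> m dvd N \<and> 0 \<le> c \<and> c < m \<and> \<not> m dvd 2}"
  proof (cases rule: subgroup_cases)
    case rotations
    then show ?thesis using normal_if_rotations[OF sub] nn by blast
  next
    case (dih_sub m c)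
    then have "\<not> m dvd 2" using nn by (simp add: normal_dih_sub_iff)
    then show ?thesis using dih_sub by blast
  qed
next
  fix H assume "H \<in> {dih_sub m c | m c. 0 < m \<and> m dvd N \<and> 0 \<le> c \<and> c < m \<and> \<not> m dvd 2}"
  then obtain m c where H: "H = dih_sub m c" "m dvd N" "\<not> m dvd 2" by auto
  then have nn: "\<not> H \<lhd> G" by (simp add: normal_dih_sub_iff)
  \<comment> \<open>The whole group is normal while \<open>H\<close> is not, so \<open>H\<close> is
    proper.\<close>
  moreover have "carrier G \<lhd> G"
    by (simp add: normal_inv_iff subgroup_self)
  ultimately show "H \<in> GammaN_verts G"
    using subgroup_dih_sub[OF H(2)] H(1) by (auto simp: GammaN_verts_def)
qed

section \<open>Products of two subgroups\<close>

lemma el_in_set_mult_iff: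
  assumes "H \<subseteq> carrier G" "K \<subseteq> carrier G"
  shows "el e x \<in> H <#> K \<longleftrightarrow> (\<exists>f y. el f y \<in> H \<and> inv (el f y) \<otimes> el e x \<in> K)"
proof
  assume "el e x \<in> H <#> K"
  then obtain h k where hk: "h \<in> H" "k \<in> K" "el e x = h \<otimes> k" by (auto simp: set_mult_def)
  obtain f y where h: "h = el f y" using hk(1) assms(1) by (auto simp: carrier_eq)
  have "inv (el f y) \<otimes> el e x = k"
    using hk assms by (auto simp flip: m_assoc simp: h)
  then show "\<exists>f y. el f y \<in> H \<and> inv (el f y) \<otimes> el e x \<in> K" using hk(1,2) h by metis
next
  assume "\<exists>f y. el f y \<in> H \<and> inv (el f y) \<otimes> el e x \<in> K"
  then obtain f y where fy: "el f y \<in> H" "inv (el f y) \<otimes> el e x \<in> K" by blast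
  have "el e x = el f y \<otimes> (inv (el f y) \<otimes> el e x)" by (simp flip: m_assoc)
  then show "el e x \<in> H <#> K" using fy by (auto simp: set_mult_def)
qed

text \<open>Once the first factor is chosen, the second is determined, so membership is a pair of
  congruences on one exponent, solvable by a gcd condition. The two disjuncts come from a first
  factor that is a reflection or a rotation.\<close>

lemma el_in_dih_sub_mult_iff:
  assumes "m dvd N" "k dvd N"
  shows "el e x \<in> dih_sub m c <#> dih_sub k d \<longleftrightarrow>
    (if e then gcd m k dvd x - c \<or> gcd m k dvd x - d
     else gcd m k dvd x \<or> gcd m k dvd x - (d - c))"
proof -
  \<comment> \<open>\<open>ex\<close> serves the cases where the second factor is a rotation,
    \<open>ex'\<close> those where it is a reflection.\<close>
  have ex: "(\<exists>y. m dvd y - p \<and> k dvd q - y) \<longleftrightarrow> gcd m k dvd p - q" for p q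
    by (simp add: dvd_diff_commute[of k q] ex_cong_both_iff_gcd_dvd)
  have ex': "(\<exists>y. m dvd y - p \<and> k dvd q + y) \<longleftrightarrow> gcd m k dvd p + q" for p q
    using ex_cong_both_iff_gcd_dvd[of m p k "- q"] by (simp add: add.commute)
  have comm: "gcd m k dvd p - q \<longleftrightarrow> gcd m k dvd q - p" for p q
    by (rule dvd_diff_commute)
  have "el e x \<in> dih_sub m c <#> dih_sub k d \<longleftrightarrow>
     (\<exists>y. m dvd y - c \<and> inv (el True y) \<otimes> el e x \<in> dih_sub k d) \<or>
     (\<exists>y. m dvd y - 0 \<and> inv (el False y) \<otimes> el e x \<in> dih_sub k d)"
    by (simp add: el_in_set_mult_iff[OF dih_sub_subset dih_sub_subset] el_in_dih_sub_iff[OF assms(1)] ex_bool_eq)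
  also have "\<dots> \<longleftrightarrow> (if e then gcd m k dvd x - c \<or> gcd m k dvd x - d
     else gcd m k dvd x \<or> gcd m k dvd x - (d - c))"
  proof (cases e)
    case True
    then show ?thesis
      using ex[of c x] ex'[of 0 "x - d"] comm[of c x]
      by (simp add: inv_el el_mult el_in_dih_sub_iff[OF assms(2)] algebra_simps)
  next
    case False
    then show ?thesis
      using ex[of 0 x] ex'[of c "x - d"]
      by (auto simp: inv_el el_mult el_in_dih_sub_iff[OF assms(2)] algebra_simps)
  qed
  finally show ?thesis .
qed

text \<open>Both products contain the same reflections. Modulo the gcd, their rotations fill the
  classes of 0 and \<open>d - c\<close> in one order, and of 0 and \<open>c - d\<close> in the
  other.\<close>

lemma dih_sub_permute_iff:
  assumes "m dvd N" "k dvd N"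
  shows "dih_sub m c <#> dih_sub k d = dih_sub k d <#> dih_sub m c \<longleftrightarrow> gcd m k dvd 2 * (c - d)"
    (is "?L = ?R \<longleftrightarrow> ?g dvd _")
proof -
  have sub: "?L \<subseteq> carrier G" "?R \<subseteq> carrier G"
    by (simp_all add: set_mult_closed dih_sub_subset)
  have "?L = ?R \<longleftrightarrow> (\<forall>x. ?g dvd x \<or> ?g dvd x - (d - c) \<longleftrightarrow> ?g dvd x \<or> ?g dvd x - (c - d))"
    by (auto simp: set_eq_iff_el[OF sub] all_bool_eq el_in_dih_sub_mult_iff assms gcd.commute[of k m])
  also have "\<dots> \<longleftrightarrow> ?g dvd 2 * (c - d)"
  proof
    assume *: "\<forall>x. ?g dvd x \<or> ?g dvd x - (d - c) \<longleftrightarrow> ?g dvd x \<or> ?g dvd x - (c - d)"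
    \<comment> \<open>The exponent \<open>c - d\<close> occurs in the second product, so it must
      occur in the first.\<close>
    from *[rule_format, of "c - d"] have "?g dvd c - d \<or> ?g dvd 2 * (c - d)" by auto
    then show "?g dvd 2 * (c - d)" by (blast intro: dvd_mult)
  next
    assume d: "?g dvd 2 * (c - d)"
    have "?g dvd x - (d - c) \<longleftrightarrow> ?g dvd x - (c - d)" for x
      using dvd_add_left_iff[OF d, of "x - (c - d)"] by (simp add: algebra_simps)
    then show "\<forall>x. ?g dvd x \<or> ?g dvd x - (d - c) \<longleftrightarrow> ?g dvd x \<or> ?g dvd x - (c - d)" by simp
  qed
  finally show ?thesis .
qed

end

section \<open>Normal forms in the presented group\<close>

text \<open>Left multiplication of $b^e a^x$ by a letter.\<close>

fun letter_act :: "dihedral_gen \<times> bool \<Rightarrow> bool \<times> int \<Rightarrow> bool \<times> int" where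
  "letter_act (A, s) (e, x) = (e, if s = e then x - 1 else x + 1)"
| "letter_act (B, s) (e, x) = (\<not> e, x)"

definition word_act :: "dihedral_gen gword \<Rightarrow> bool \<times> int \<Rightarrow> bool \<times> int" where
  "word_act w = foldr letter_act w"

text \<open>Letters act on integer exponents, so the relation making the \<open>n\<close>-th power
  of \<open>A\<close> trivial is respected only up to this congruence.\<close>

definition state_cong :: "nat \<Rightarrow> bool \<times> int \<Rightarrow> bool \<times> int \<Rightarrow> bool" where
  "state_cong n p q \<longleftrightarrow> fst p = fst q \<and> int n dvd snd p - snd q"

lemma word_act_append: "word_act (u @ v) p = word_act u (word_act v p)"
  by (simp add: word_act_def)

lemma state_cong_refl: "state_cong n p p"
  by (simp add: state_cong_def)

lemma state_cong_sym: "state_cong n p q \<Longrightarrow> state_cong n q p"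
  by (simp add: state_cong_def dvd_diff_commute)

lemma state_cong_trans: "state_cong n p q \<Longrightarrow> state_cong n q t \<Longrightarrow> state_cong n p t"
  unfolding state_cong_def by (metis (no_types, lifting) diff_add_cancel add_diff_eq dvd_add)

lemma state_cong_word_act:
  assumes "state_cong n p q"
  shows "state_cong n (word_act w p) (word_act w q)"
proof (induction w)
  case (Cons l w)
  obtain g s where l: "l = (g, s)" by force
  show ?case
    using Cons
    by (cases g; cases "word_act w p"; cases "word_act w q")
       (auto simp: word_act_def l state_cong_def)
qed (simp add: word_act_def assms)

lemma word_act_replicate_A: "word_act (replicate k (A, True)) (e, x) = (e, if e then x - int k else x + int k)"
  by (induction k) (auto simp: word_act_def)

text \<open>Cancelling pairs act as the identity and the two sides of each relation act congruently.
  This invariant shows that the relations do not identify further normal forms.\<close>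

lemma word_eq_imp_state_cong:
  assumes "word_eq (dihedral_relations n) u v"
  shows "state_cong n (word_act u p) (word_act v p)"
  using assms
proof (induction arbitrary: p)
  case (cancel u g s v)
  have "word_act [(g, s), (g, \<not> s)] q = q" for q
    by (cases g; cases q) (auto simp: word_act_def)
  then have "word_act (u @ [(g, s), (g, \<not> s)] @ v) p = word_act (u @ v) p"
    by (simp only: word_act_append)
  then show ?case by (simp add: state_cong_refl)
next
  case (relation l r u v)
  have "state_cong n (word_act l q) (word_act r q)" for q
    using relation
    by (cases q) (auto simp: dihedral_relations_def word_act_replicate_A,
        auto simp: word_act_def state_cong_def)
  then show ?case by (simp add: word_act_append state_cong_word_act)
qed (blast intro: state_cong_refl state_cong_sym state_cong_trans)+

lemma (in group) int_pow_mult_involution: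
  assumes "a \<in> carrier G" "b \<in> carrier G" "a \<otimes> b = b \<otimes> inv a"
  shows "a [^] (k::int) \<otimes> b = b \<otimes> a [^] (- k)"
proof -
  have nat: "a [^] m \<otimes> b = b \<otimes> inv (a [^] m)" for m :: nat
  proof (induction m)
    case (Suc m)
    have "a [^] Suc m \<otimes> b = a [^] m \<otimes> b \<otimes> inv a" using assms by (simp add: m_assoc)
    also have "\<dots> = b \<otimes> (inv (a [^] m) \<otimes> inv a)" using assms Suc by (simp add: m_assoc)
    also have "inv (a [^] m) \<otimes> inv a = inv (a [^] Suc m)"
      using assms by (simp add: inv_mult_group[symmetric] nat_pow_Suc2[symmetric])
    finally show ?case .
  qed (use assms in simp)
  show ?thesis
  proof (cases k)
    case (nonneg m)
    then show ?thesis using nat assms by (simp add: int_pow_neg int_pow_int)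
  next
    case (neg m)
    \<comment> \<open>Negative exponents: the rule for the positive power is solved for
      \<open>b\<close> and then multiplied on the right by that power.\<close>
    have "b = inv (a [^] Suc m) \<otimes> (a [^] Suc m \<otimes> b)"
      using assms inv_solve_left'[of b "a [^] Suc m" "a [^] Suc m \<otimes> b"] by (simp del: nat_pow_Suc)
    also have "\<dots> = inv (a [^] Suc m) \<otimes> b \<otimes> inv (a [^] Suc m)"
      using assms nat[of "Suc m"] by (simp add: m_assoc del: nat_pow_Suc)
    finally have "b \<otimes> a [^] Suc m = inv (a [^] Suc m) \<otimes> b"
      using assms by (metis inv_closed inv_solve_right' m_closed nat_pow_closed inv_solve_right)
    then show ?thesis using assms unfolding neg
      by (simp add: int_pow_neg int_pow_int del: of_nat_Suc nat_pow_Suc)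
  qed
qed

text \<open>The concrete \<open>el\<close> with which the locale \<open>dihedral_coords\<close> is
  instantiated.\<close>

definition dih_el :: "nat \<Rightarrow> bool \<Rightarrow> int \<Rightarrow> dihedral_gen gword set" where
  "dih_el n e x = (if e then gen_b n else \<one>\<^bsub>dihedral_group n\<^esub>)
     \<otimes>\<^bsub>dihedral_group n\<^esub> gen_a n [^]\<^bsub>dihedral_group n\<^esub> x"

section \<open>Existence and uniqueness of normal forms\<close>

context
  fixes n :: nat
begin

interpretation D: group "dihedral_group n"
  unfolding dihedral_group_def by (rule group_presented_group)

abbreviation (input) "D \<equiv> dihedral_group n"
abbreviation (input) "wc \<equiv> word_class (dihedral_relations n)"

lemma wc_mult: "wc u \<otimes>\<^bsub>D\<^esub> wc v = wc (u @ v)"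
  by (simp add: dihedral_group_def mult_presented_group)

lemma wc_one: "\<one>\<^bsub>D\<^esub> = wc []"
  by (simp add: dihedral_group_def one_presented_group)

lemma wc_carrier: "carrier D = range wc"
  by (simp add: dihedral_group_def carrier_presented_group)

lemma wc_relation: "(l, r) \<in> dihedral_relations n \<Longrightarrow> wc l = wc r"
  using word_eq.relation[of l r "dihedral_relations n" "[]" "[]"] by (simp add: word_class_eq_iff)

lemma gens_closed: "gen_a n \<in> carrier D" "gen_b n \<in> carrier D"
  by (simp_all add: wc_carrier gen_a_def gen_b_def)

lemma inv_letter: "inv\<^bsub>D\<^esub> (wc [(g, True)]) = wc [(g, False)]"
proof (rule D.inv_equality)
  show "wc [(g, False)] \<otimes>\<^bsub>D\<^esub> wc [(g, True)] = \<one>\<^bsub>D\<^esub>"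
    using word_eq.cancel[of "dihedral_relations n" "[]" g False "[]"]
    by (simp add: wc_mult wc_one word_class_eq_iff)
qed (simp_all add: wc_carrier)

lemma gen_a_pow_replicate: "gen_a n [^]\<^bsub>D\<^esub> (k::nat) = wc (replicate k (A, True))"
  by (induction k) (simp_all add: wc_one gen_a_def wc_mult replicate_append_same)

lemma gen_a_pow_n: "gen_a n [^]\<^bsub>D\<^esub> n = \<one>\<^bsub>D\<^esub>"
  unfolding gen_a_pow_replicate wc_one by (rule wc_relation) (simp add: dihedral_relations_def)

lemma gen_b_square: "gen_b n \<otimes>\<^bsub>D\<^esub> gen_b n = \<one>\<^bsub>D\<^esub>"
  unfolding gen_b_def wc_mult wc_one by (rule wc_relation) (simp add: dihedral_relations_def)

lemma gen_a_gen_b: "gen_a n \<otimes>\<^bsub>D\<^esub> gen_b n = gen_b n \<otimes>\<^bsub>D\<^esub> inv\<^bsub>D\<^esub> (gen_a n)"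
  unfolding gen_a_def gen_b_def inv_letter wc_mult
  by (rule wc_relation) (simp add: dihedral_relations_def)

lemma dih_el_closed: "dih_el n e x \<in> carrier D"
  by (simp add: dih_el_def gens_closed)

lemma dih_el_mult:
  "dih_el n e x \<otimes>\<^bsub>D\<^esub> dih_el n f y = dih_el n (e \<noteq> f) (y + (if f then - x else x))"
proof -
  define p where "p = (if e then gen_b n else \<one>\<^bsub>D\<^esub>)"
  have p: "p \<in> carrier D" by (simp add: p_def gens_closed)
  show ?thesis
  proof (cases f)
    case False
    then show ?thesis
      by (simp add: dih_el_def gens_closed D.m_assoc D.int_pow_mult add.commute[of y] p_def)
  next
    case True
    have "dih_el n e x \<otimes>\<^bsub>D\<^esub> dih_el n f y
        = p \<otimes>\<^bsub>D\<^esub> (gen_a n [^]\<^bsub>D\<^esub> x \<otimes>\<^bsub>D\<^esub> gen_b n) \<otimes>\<^bsub>D\<^esub> gen_a n [^]\<^bsub>D\<^esub> y"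
      using True p by (simp add: dih_el_def gens_closed D.m_assoc flip: p_def)
    \<comment> \<open>Moving \<open>gen_b n\<close> to the left past a power of
      \<open>gen_a n\<close> negates the exponent.\<close>
    also have "\<dots> = (p \<otimes>\<^bsub>D\<^esub> gen_b n) \<otimes>\<^bsub>D\<^esub> (gen_a n [^]\<^bsub>D\<^esub> (- x) \<otimes>\<^bsub>D\<^esub> gen_a n [^]\<^bsub>D\<^esub> y)"
      using p by (simp add: D.int_pow_mult_involution gens_closed gen_a_gen_b D.m_assoc)
    also have "p \<otimes>\<^bsub>D\<^esub> gen_b n = (if e \<noteq> f then gen_b n else \<one>\<^bsub>D\<^esub>)"
      using True by (auto simp: p_def gen_b_square gens_closed)
    finally show ?thesis
      using True by (simp add: dih_el_def gens_closed D.int_pow_mult[symmetric] add.commute[of y])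
  qed
qed

lemma wc_letter:
  "wc [(g, s)] = dih_el n (fst (letter_act (g, s) (False, 0))) (snd (letter_act (g, s) (False, 0)))"
proof (cases g)
  case A
  then show ?thesis
    using inv_letter[of A] gens_closed(1) D.inv_closed[OF gens_closed(1)]
    by (cases s) (simp_all add: dih_el_def gens_closed D.int_pow_neg gen_a_def D.int_pow_1)
next
  case B
  have "inv\<^bsub>D\<^esub> (gen_b n) = gen_b n"
    by (rule D.inv_equality[OF gen_b_square gens_closed(2) gens_closed(2)])
  then show ?thesis
    using B inv_letter[of B] gens_closed(2)
    by (cases s) (simp_all add: dih_el_def gen_b_def)
qed

text \<open>Existence of normal forms: \<open>(False, 0)\<close> is the state of the identity, and
  the letters of \<open>w\<close> act on it as successive left multiplications.\<close>

lemma wc_eq_dih_el: "wc w = dih_el n (fst (word_act w (False, 0))) (snd (word_act w (False, 0)))"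
proof (induction w)
  case Nil
  then show ?case by (simp add: word_act_def dih_el_def wc_one[symmetric])
next
  case (Cons l w)
  obtain g s where l: "l = (g, s)" by force
  obtain e x where ex: "word_act w (False, 0) = (e, x)" by force
  have "wc (l # w) = wc [(g, s)] \<otimes>\<^bsub>D\<^esub> wc w" by (simp add: wc_mult l)
  also have "\<dots> = dih_el n (fst (letter_act (g, s) (e, x))) (snd (letter_act (g, s) (e, x)))"
    unfolding wc_letter Cons ex by (cases g) (auto simp: dih_el_mult)
  finally show ?case using ex by (simp add: word_act_def l)
qed

lemma dih_el_cong:
  assumes "int n dvd x - y"
  shows "dih_el n e x = dih_el n e y"
proof -
  obtain k where k: "x - y = int n * k" using assms by blast
  have "x = int n * k + y" using k by simp
  moreover have "gen_a n [^]\<^bsub>D\<^esub> (int n * k) = \<one>\<^bsub>D\<^esub>"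
    using gens_closed(1) by (simp add: D.int_pow_pow[symmetric] int_pow_int gen_a_pow_n)
  ultimately show ?thesis by (simp add: dih_el_def D.int_pow_mult gens_closed)
qed

text \<open>Uniqueness of normal forms: both elements are represented by explicit words, whose
  actions on \<open>(False, 0)\<close> reveal the flag and the exponent modulo
  \<open>n\<close>.\<close>

lemma dih_el_eq_iff:
  assumes "0 < n"
  shows "dih_el n e x = dih_el n f y \<longleftrightarrow> e = f \<and> int n dvd x - y"
proof
  assume eq: "dih_el n e x = dih_el n f y"
  \<comment> \<open>A word can repeat a letter only a natural number of times, hence the residue in
    place of \<open>x\<close>.\<close>
  define nf where "nf e x = (if e then [(B, True)] else []) @ replicate (nat (x mod int n)) (A, True)"
    for e and x :: int
  have act: "word_act (nf e x) (False, 0) = (e, x mod int n)" for e x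
  proof -
    have "word_act (replicate (nat (x mod int n)) (A, True)) (False, 0) = (False, x mod int n)"
      using assms by (simp add: word_act_replicate_A)
    then show ?thesis by (simp add: nf_def word_act_append) (simp add: word_act_def)
  qed
  have wc: "dih_el n e x = wc (nf e x)" for e x
    unfolding wc_eq_dih_el act by (simp add: dih_el_cong minus_mod_eq_mult_div)
  have "word_eq (dihedral_relations n) (nf e x) (nf f y)"
    using eq by (simp add: wc word_class_eq_iff)
  from word_eq_imp_state_cong[OF this, of "(False, 0)"]
  have "e = f" and "int n dvd x mod int n - y mod int n" by (simp_all add: act state_cong_def)
  then show "e = f \<and> int n dvd x - y" by (simp add: mod_eq_dvd_iff[symmetric])
qed (use dih_el_cong in blast)

lemma dihedral_coords_dihedral_group:
  assumes "0 < n"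
  shows "dihedral_coords D (dih_el n) (int n)"
proof
  show "carrier D = {dih_el n e x | e x. True}"
    using dih_el_closed wc_eq_dih_el by (auto simp: wc_carrier)
qed (use assms dih_el_eq_iff dih_el_mult in simp_all)

lemma H_sub_eq_dih_sub:
  assumes "0 < n" "r dvd n" "1 \<le> i"
  shows "H_sub n r i = dihedral_coords.dih_sub (dih_el n) (int (n div r)) (int i - 1)"
proof -
  interpret C: dihedral_coords D "dih_el n" "int n" using assms(1) by (rule dihedral_coords_dihedral_group)
  have "0 < n div r" using assms by (auto elim!: dvdE)
  then have "C.dih_sub (int (n div r)) (int i - 1)
      = generate D {dih_el n False (int (n div r)), dih_el n True (int i - 1)}"
    using assms by (intro C.generate_eq_dih_sub[symmetric]) auto
  moreover have "dih_el n False (int (n div r)) = gen_a n [^]\<^bsub>D\<^esub> (n div r)"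
    by (simp add: dih_el_def gens_closed int_pow_int)
  \<comment> \<open>With \<open>1 \<le> i\<close> the natural and the integer subtraction
    agree.\<close>
  moreover have "dih_el n True (int i - 1) = gen_b n \<otimes>\<^bsub>D\<^esub> gen_a n [^]\<^bsub>D\<^esub> (i - 1)"
    using assms(3) int_pow_int[of D "gen_a n" "i - 1"] by (simp add: dih_el_def of_nat_diff)
  ultimately show ?thesis by (simp add: H_sub_def)
qed

end

section \<open>Counting\<close>

definition H_indices :: "nat \<Rightarrow> (nat \<times> nat) set" where
  "H_indices n = {(s, j). 0 < s \<and> s dvd n \<and> 1 \<le> j \<and> j \<le> n div s}"

definition permuting_indices :: "nat \<Rightarrow> nat \<Rightarrow> nat \<Rightarrow> (nat \<times> nat) set" where
  "permuting_indices n r i =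
     {(s, j) \<in> H_indices n. int (n div lcm r s) dvd 2 * (int i - int j)}"

lemma finite_permuting_indices:
  assumes "0 < n"
  shows "finite (permuting_indices n r i)"
proof (rule finite_subset)
  show "permuting_indices n r i \<subseteq> {..n} \<times> {..n}"
    using assms div_le_dividend le_trans
    by (fastforce simp: permuting_indices_def H_indices_def dest: dvd_imp_le)
qed simp

lemma x_count_eq: "x_count n r i = card (permuting_indices n r i)"
  unfolding x_count_def permuting_indices_def H_indices_def by (rule arg_cong[of _ _ card]) auto

text \<open>The coordinate results carried over to the presented group, with
  \<open>m = n div s\<close> and \<open>c = j - 1\<close>.\<close>

lemma H_sub_facts:
  assumes "0 < n"
  shows H_sub_inj: "inj_on (\<lambda>(s, j). H_sub n s j) (H_indices n)"
    and GammaN_verts_dihedral: "GammaN_verts (dihedral_group n)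
      = (\<lambda>(s, j). H_sub n s j) ` {(s, j) \<in> H_indices n. \<not> n div s dvd 2}"
    and H_sub_permute_iff: "(r, i) \<in> H_indices n \<Longrightarrow> (s, j) \<in> H_indices n \<Longrightarrow>
      H_sub n r i <#>\<^bsub>dihedral_group n\<^esub> H_sub n s j = H_sub n s j <#>\<^bsub>dihedral_group n\<^esub> H_sub n r i
      \<longleftrightarrow> int (n div lcm r s) dvd 2 * (int i - int j)"
proof -
  interpret C: dihedral_coords "dihedral_group n" "dih_el n" "int n"
    using assms by (rule dihedral_coords_dihedral_group)
  have H: "H_sub n s j = C.dih_sub (int (n div s)) (int j - 1)" "0 < n div s" "n div s dvd n"
    if "(s, j) \<in> H_indices n" for s j
    using that assms by (auto simp: H_indices_def H_sub_eq_dih_sub elim!: dvdE)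
  show "inj_on (\<lambda>(s, j). H_sub n s j) (H_indices n)"
  proof (rule inj_onI, clarify)
    fix s j t k assume sj: "(s, j) \<in> H_indices n" and tk: "(t, k) \<in> H_indices n"
      and "H_sub n s j = H_sub n t k"
    then have eq: "n div s = n div t" and dvd: "int (n div s) dvd int j - int k"
      using H[OF sj] H[OF tk] C.dih_sub_eq_iff[of "int (n div s)" "int (n div t)" "int j - 1" "int k - 1"]
      by auto
    \<comment> \<open>Taking complementary divisors twice recovers the divisor.\<close>
    have "s = n div (n div s)" "t = n div (n div t)"
      using sj tk assms by (auto simp: H_indices_def div_div_eq_right)
    with eq have "s = t" by metis
    \<comment> \<open>Both indices lie in one complete residue system modulo \<open>n div s\<close>,
      so congruence means equality.\<close>
    have "\<bar>int j - int k\<bar> < int (n div s)" using sj tk \<open>s = t\<close> by (auto simp: H_indices_def)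
    then have "j = k" using dvd zdvd_imp_le[of "int (n div s)" "\<bar>int j - int k\<bar>"] by force
    with \<open>s = t\<close> show "s = t \<and> j = k" ..
  qed
  show "H_sub n r i <#>\<^bsub>dihedral_group n\<^esub> H_sub n s j = H_sub n s j <#>\<^bsub>dihedral_group n\<^esub> H_sub n r i
      \<longleftrightarrow> int (n div lcm r s) dvd 2 * (int i - int j)"
    if "(r, i) \<in> H_indices n" "(s, j) \<in> H_indices n"
  proof -
    have "gcd (n div r) (n div s) = n div lcm r s"
      using that assms by (intro gcd_div_div_eq_div_lcm) (auto simp: H_indices_def)
    then show ?thesis
      using H[OF that(1)] H[OF that(2)] by (simp add: C.dih_sub_permute_iff)
  qed
  show "GammaN_verts (dihedral_group n)
      = (\<lambda>(s, j). H_sub n s j) ` {(s, j) \<in> H_indices n. \<not> n div s dvd 2}"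
  proof (intro equalityI subsetI)
    fix K assume "K \<in> GammaN_verts (dihedral_group n)"
    then obtain m c where K: "K = C.dih_sub m c" and m: "0 < m" "m dvd int n" "\<not> m dvd 2"
      and c: "0 \<le> c" "c < m" by (auto simp: C.GammaN_verts_eq)
    \<comment> \<open>Inverts \<open>m = n div s\<close>, \<open>c = j - 1\<close>; the bound
      \<open>c < m\<close> becomes \<open>j \<le> n div s\<close>.\<close>
    define s j where "s = n div nat m" and "j = nat c + 1"
    have "nat m dvd n" using m by (simp add: nat_dvd_iff)
    then have s: "n div s = nat m" "0 < s" "s dvd n"
      using assms by (auto simp: s_def elim!: dvdE)
    have "(s, j) \<in> H_indices n" using s c m by (auto simp: H_indices_def j_def)
    moreover have "K = H_sub n s j" using H(1)[OF calculation] c m by (simp add: K s j_def)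
    moreover have "\<not> n div s dvd 2" using m by (simp add: s nat_dvd_iff)
    ultimately show "K \<in> (\<lambda>(s, j). H_sub n s j) ` {(s, j) \<in> H_indices n. \<not> n div s dvd 2}" by force
  next
    fix K assume "K \<in> (\<lambda>(s, j). H_sub n s j) ` {(s, j) \<in> H_indices n. \<not> n div s dvd 2}"
    then obtain s j where sj: "(s, j) \<in> H_indices n" and "\<not> n div s dvd 2" "K = H_sub n s j" by auto
    moreover have "int j - 1 < int (n div s)" "0 \<le> int j - 1" using sj by (auto simp: H_indices_def)
    moreover have "\<not> int (n div s) dvd 2" using \<open>\<not> n div s dvd 2\<close> int_dvd_int_iff[of _ 2] by simp
    ultimately show "K \<in> GammaN_verts (dihedral_group n)"
      using H[OF sj] unfolding C.GammaN_verts_eq by (intro CollectI exI conjI) auto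
  qed
qed

text \<open>By injectivity of the indexing, neighbours can be counted as indices: the permuting
  ones, without the vertex itself and without the normal subgroups.\<close>

lemma GammaN_degree_H_sub:
  assumes "0 < n" "(r, i) \<in> H_indices n" "\<not> n div r dvd 2"
  shows "GammaN_degree (dihedral_group n) (H_sub n r i)
    = card (permuting_indices n r i - insert (r, i) {(s, j) \<in> H_indices n. n div s dvd 2})"
proof -
  let ?h = "\<lambda>(s, j). H_sub n s j"
  let ?Q = "permuting_indices n r i - insert (r, i) {(s, j) \<in> H_indices n. n div s dvd 2}"
  have sub: "?Q \<subseteq> H_indices n" by (auto simp: permuting_indices_def)
  have eq_iff: "H_sub n r i = H_sub n s j \<longleftrightarrow> (r, i) = (s, j)" if "(s, j) \<in> H_indices n" for s j
    using inj_on_eq_iff[OF H_sub_inj[OF assms(1)] assms(2) that] by simp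
  have "{K. GammaN_adj (dihedral_group n) (H_sub n r i) K} = ?h ` ?Q"
  proof (intro equalityI subsetI)
    fix K assume "K \<in> {K. GammaN_adj (dihedral_group n) (H_sub n r i) K}"
    then obtain s j where sj: "(s, j) \<in> H_indices n" "\<not> n div s dvd 2" "K = H_sub n s j"
      and "H_sub n r i \<noteq> K"
      and perm: "H_sub n r i <#>\<^bsub>dihedral_group n\<^esub> K = K <#>\<^bsub>dihedral_group n\<^esub> H_sub n r i"
      by (auto simp: GammaN_adj_def GammaN_verts_dihedral[OF assms(1)])
    then have "(s, j) \<in> ?Q"
      using H_sub_permute_iff[OF assms(1,2) sj(1)] eq_iff by (auto simp: permuting_indices_def)
    then show "K \<in> ?h ` ?Q" using sj(3) by force
  next
    fix K assume "K \<in> ?h ` ?Q"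
    then obtain s j where sj: "(s, j) \<in> ?Q" and K: "K = H_sub n s j" by auto
    have idx: "(s, j) \<in> H_indices n" and "\<not> n div s dvd 2" using sj sub by auto
    then have "K \<in> GammaN_verts (dihedral_group n)"
      using K unfolding GammaN_verts_dihedral[OF assms(1)] by force
    moreover have "H_sub n r i \<in> GammaN_verts (dihedral_group n)"
      using assms unfolding GammaN_verts_dihedral[OF assms(1)] by force
    moreover have "H_sub n r i \<noteq> K" using eq_iff[OF idx] sj K by auto
    ultimately show "K \<in> {K. GammaN_adj (dihedral_group n) (H_sub n r i) K}"
      using H_sub_permute_iff[OF assms(1,2) idx] sj K
      by (auto simp: GammaN_adj_def permuting_indices_def)
  qed
  then show ?thesis
    unfolding GammaN_degree_def
    using card_image[OF inj_on_subset[OF H_sub_inj[OF assms(1)] sub]] by simp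
qed

text \<open>A normal subgroup permutes with every subgroup; in indices, \<open>n div lcm r s\<close>
  divides \<open>n div s\<close>, which divides 2.\<close>

lemma normal_indices_permute:
  assumes "0 < n" "r dvd n"
  shows "{(s, j) \<in> H_indices n. n div s dvd 2} \<subseteq> permuting_indices n r i"
proof clarify
  fix s j assume idx: "(s, j) \<in> H_indices n" and "n div s dvd 2"
  have "n div lcm r s = gcd (n div r) (n div s)"
    using gcd_div_div_eq_div_lcm[of n r s] assms idx by (auto simp: H_indices_def)
  then have "n div lcm r s dvd 2" using \<open>n div s dvd 2\<close> by (metis dvd_trans gcd_dvd2)
  then have "int (n div lcm r s) dvd 2" using int_dvd_int_iff[of _ 2] by simp
  then show "(s, j) \<in> permuting_indices n r i" using idx by (simp add: permuting_indices_def)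
qed

text \<open>All removed indices are among those counted by \<open>x_count\<close>, and
  \<open>(r, i)\<close> is not one of the normal indices, so the cardinalities add up. The additive
  form avoids truncated subtraction.\<close>

lemma degree_plus_normal:
  assumes "0 < n" "(r, i) \<in> H_indices n" "\<not> n div r dvd 2"
  shows "x_count n r i = GammaN_degree (dihedral_group n) (H_sub n r i)
    + Suc (card {(s, j) \<in> H_indices n. n div s dvd 2})"
proof -
  let ?N = "{(s, j) \<in> H_indices n. n div s dvd 2}"
  have sub: "insert (r, i) ?N \<subseteq> permuting_indices n r i"
    using normal_indices_permute[of n r i] assms by (auto simp: permuting_indices_def H_indices_def)
  have fin: "finite (insert (r, i) ?N)"
    by (rule finite_subset[OF sub finite_permuting_indices[OF assms(1)]])
  have "card (insert (r, i) ?N) = Suc (card ?N)" using fin assms(3) by simp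
  then show ?thesis
    unfolding GammaN_degree_H_sub[OF assms] x_count_eq
    using card_Diff_subset[OF fin sub] card_mono[OF finite_permuting_indices[OF assms(1)] sub] by simp
qed

text \<open>The quotient \<open>n div s = 1\<close> gives the whole group; for even
  \<open>n\<close>, the quotient 2 gives two subgroups of index 2.\<close>

lemma card_normal_indices:
  assumes "n \<ge> 3"
  shows "card {(s, j) \<in> H_indices n. n div s dvd 2} = (if even n then 3 else 1)"
proof -
  have s: "0 < s \<and> s dvd n \<and> n div s = 1 \<longleftrightarrow> s = n"
    "0 < s \<and> s dvd n \<and> n div s = 2 \<longleftrightarrow> even n \<and> s = n div 2" for s
    using assms by (auto elim!: dvdE)
  have "{(s, j) \<in> H_indices n. n div s dvd 2} =
    {(s, j). (s = n \<and> j = 1) \<or> (even n \<and> s = n div 2 \<and> (j = 1 \<or> j = 2))}" (is "?L = ?R")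
  proof -
    have "(s, j) \<in> ?L \<longleftrightarrow> (0 < s \<and> s dvd n \<and> n div s = 1) \<and> j = 1 \<or>
      (0 < s \<and> s dvd n \<and> n div s = 2) \<and> (j = 1 \<or> j = 2)" for s j
      by (auto simp: H_indices_def dvd_two_iff_nat)
    then show ?thesis unfolding s by auto
  qed
  also have "\<dots> = (if even n then {(n, 1), (n div 2, 1), (n div 2, 2)} else {(n, 1)})" by auto
  finally show ?thesis using assms by auto
qed

theorem theorem4p1:
  fixes n :: nat
  assumes "n \<ge> 3"
  shows "(odd n \<longrightarrow>
           (\<forall>r i. r dvd n \<and> r \<noteq> n \<and> 1 \<le> i \<and> i \<le> n div r \<longrightarrow>
              int (GammaN_degree (dihedral_group n) (H_sub n r i)) = int (x_count n r i) - 2)) \<and>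
         (even n \<longrightarrow>
           (\<forall>r i. r dvd n \<and> r \<noteq> n \<and> r \<noteq> n div 2 \<and> 1 \<le> i \<and> i \<le> n div r \<longrightarrow>
              int (GammaN_degree (dihedral_group n) (H_sub n r i)) = int (x_count n r i) - 4))"
proof -
  have key: "x_count n r i = GammaN_degree (dihedral_group n) (H_sub n r i) + (if even n then 4 else 2)"
    if r: "r dvd n" "r \<noteq> n" "even n \<longrightarrow> r \<noteq> n div 2" and i: "1 \<le> i" "i \<le> n div r" for r i
  proof -
    have idx: "(r, i) \<in> H_indices n" using r i assms by (auto simp: H_indices_def intro!: Nat.gr0I)
    obtain k where n: "n = r * k" using r(1) by blast
    then have "r > 0" using assms by (auto intro!: Nat.gr0I)
    \<comment> \<open>\<open>k = 1\<close> would mean \<open>r = n\<close>; \<open>k = 2\<close>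
      would make \<open>n\<close> even with \<open>r = n div 2\<close>.\<close>
    moreover have "k \<noteq> 1" "k \<noteq> 2" using n r by auto
    ultimately have "\<not> n div r dvd 2" using n by (simp add: dvd_two_iff_nat)
    then show ?thesis
      using degree_plus_normal[OF _ idx] card_normal_indices[OF assms] assms by auto
  qed
  show ?thesis using key by auto
qed

end
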